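(* Let $t(n)$ denote the smallest number of distinct lines in a $3$-metric space on $n$ points. Then $t(n) = \Theta(n^{4/3})$.
   Context: A $3$-metric space is a finite metric space $(V,\rho)$ in which every distance is an integer at most $3$ (so all positive distances lie in $\{1,2,3\}$). For distinct points $a,b,c$ write $[abc]$ if $\rho(a,c) = \rho(a,b)+\rho(b,c)$; $\{a,b,c\}$ is collinear if one of $[abc],[bca],[cab]$ holds. For distinct $a,b$, the line $\overline{ab}$ is $\{a,b\}$ together with all $c$ such that $\{a,b,c\}$ is collinear. *)

theory Defs
  imports "HOL-Analysis.Abstract_Metric_Spaces" "HOL-Library.Landau_Symbols"
begin

text \<open>
  \<open>Metric_space V \<rho>\<close> asks for symmetry and nonnegativity of \<open>\<rho>\<close> also outside \<open>V\<close>.  This is harmless: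
  nothing below looks at values of \<open>\<rho>\<close> outside \<open>V\<close>, and every metric on \<open>V\<close> can be extended by 0.
\<close>
definition three_metric_space :: "'a set \<Rightarrow> ('a \<Rightarrow> 'a \<Rightarrow> real) \<Rightarrow> bool" where
  "three_metric_space V \<rho> \<longleftrightarrow>
     Metric_space V \<rho> \<and> finite V \<and> (\<forall>x\<in>V. \<forall>y\<in>V. \<rho> x y \<in> \<int> \<and> \<rho> x y \<le> 3)"

definition between :: "('a \<Rightarrow> 'a \<Rightarrow> real) \<Rightarrow> 'a \<Rightarrow> 'a \<Rightarrow> 'a \<Rightarrow> bool" where
  "between \<rho> a b c \<longleftrightarrow> distinct [a, b, c] \<and> \<rho> a c = \<rho> a b + \<rho> b c"

definition collinear_triple :: "('a \<Rightarrow> 'a \<Rightarrow> real) \<Rightarrow> 'a \<Rightarrow> 'a \<Rightarrow> 'a \<Rightarrow> bool" where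
  "collinear_triple \<rho> a b c \<longleftrightarrow> between \<rho> a b c \<or> between \<rho> b c a \<or> between \<rho> c a b"

definition line :: "'a set \<Rightarrow> ('a \<Rightarrow> 'a \<Rightarrow> real) \<Rightarrow> 'a \<Rightarrow> 'a \<Rightarrow> 'a set" where
  "line V \<rho> a b = {a, b} \<union> {c \<in> V. collinear_triple \<rho> a b c}"

definition lines :: "'a set \<Rightarrow> ('a \<Rightarrow> 'a \<Rightarrow> real) \<Rightarrow> 'a set set" where
  "lines V \<rho> = {line V \<rho> a b | a b. a \<in> V \<and> b \<in> V \<and> a \<noteq> b}"

text \<open>
  Points are taken to be natural numbers; the lemmas \<open>min_lines_le\<close> and \<open>min_lines_attained\<close> show
  that this is no restriction and that the minimum exists for every \<open>n\<close>.
\<close>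
definition min_lines :: "nat \<Rightarrow> nat" where
  "min_lines n =
     (LEAST k. \<exists>(V :: nat set) \<rho>. three_metric_space V \<rho> \<and> card V = n \<and> card (lines V \<rho>) = k)"

lemma min_lines_attained:
  "\<exists>(V :: nat set) \<rho>. three_metric_space V \<rho> \<and> card V = n \<and> card (lines V \<rho>) = min_lines n"
proof -
  define \<rho> :: "nat \<Rightarrow> nat \<Rightarrow> real" where "\<rho> = (\<lambda>x y. if x = y then 0 else 1)"
  have "three_metric_space {..<n} \<rho>"
    unfolding three_metric_space_def Metric_space_def \<rho>_def by auto
  then have "\<exists>k (V :: nat set) \<rho>. three_metric_space V \<rho> \<and> card V = n \<and> card (lines V \<rho>) = k"
    by (intro exI[of _ "card (lines {..<n} \<rho>)"] exI[of _ "{..<n}"] exI[of _ \<rho>]) simp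
  then show ?thesis
    unfolding min_lines_def by (rule LeastI_ex)
qed

lemma min_lines_le:
  fixes V :: "'a set"
  assumes "three_metric_space V \<rho>"
  shows "min_lines (card V) \<le> card (lines V \<rho>)"
proof -
  have fin: "finite V" and met: "Metric_space V \<rho>"
    and int: "\<And>x y. x \<in> V \<Longrightarrow> y \<in> V \<Longrightarrow> \<rho> x y \<in> \<int> \<and> \<rho> x y \<le> 3"
    using assms unfolding three_metric_space_def by auto
  obtain f where f: "bij_betw f {..<card V} V"
    using ex_bij_betw_nat_finite[OF fin] by (auto simp: atLeast0LessThan)
  define W where "W = {..<card V}"
  define \<sigma> where "\<sigma> = (\<lambda>i j. \<rho> (f i) (f j))"
  have inj: "inj_on f W" and img: "f ` W = V"
    using f unfolding bij_betw_def W_def by auto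
  have fW: "f i \<in> V" if "i \<in> W" for i
    using img that by auto
  have eq: "f i = f j \<longleftrightarrow> i = j" if "i \<in> W" "j \<in> W" for i j
    using inj that by (auto dest: inj_onD)
  have three: "three_metric_space W \<sigma>"
    unfolding three_metric_space_def Metric_space_def
    using met int fW eq
    by (auto simp: \<sigma>_def W_def Metric_space.nonneg Metric_space.commute Metric_space.zero
        Metric_space.triangle)
  have col: "collinear_triple \<sigma> a b c \<longleftrightarrow> collinear_triple \<rho> (f a) (f b) (f c)"
    if "a \<in> W" "b \<in> W" "c \<in> W" for a b c
    using eq that unfolding collinear_triple_def between_def \<sigma>_def by auto
  have line_eq: "f ` line W \<sigma> a b = line V \<rho> (f a) (f b)" if "a \<in> W" "b \<in> W" for a b
    using that col unfolding line_def img[symmetric] by auto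
  have "lines V \<rho> = (`) f ` lines W \<sigma>"
  proof
    show "lines V \<rho> \<subseteq> (`) f ` lines W \<sigma>"
    proof
      fix L assume "L \<in> lines V \<rho>"
      then obtain a b where "a \<in> W" "b \<in> W" "f a \<noteq> f b" "L = line V \<rho> (f a) (f b)"
        unfolding lines_def img[symmetric] by auto
      then show "L \<in> (`) f ` lines W \<sigma>"
        unfolding lines_def using line_eq by blast
    qed
    show "(`) f ` lines W \<sigma> \<subseteq> lines V \<rho>"
      unfolding lines_def using line_eq eq fW by blast
  qed
  moreover have "inj_on ((`) f) (lines W \<sigma>)"
  proof (rule inj_on_subset)
    show "inj_on ((`) f) (Pow W)"
      using inj by (rule inj_on_image_Pow)
    show "lines W \<sigma> \<subseteq> Pow W"
      unfolding lines_def line_def by auto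
  qed
  ultimately have "card (lines V \<rho>) = card (lines W \<sigma>)"
    by (simp add: card_image)
  moreover have "card W = card V"
    by (simp add: W_def)
  ultimately show ?thesis
    unfolding min_lines_def using three by (intro Least_le) metis
qed

end

theory Submission imports Defs begin

text \<open>
  Let \<open>m\<close> be the number of lines.  If \<open>t\<close> disjoint pairs at the same distance generate the same line,
  then every two of them are separated by a line which contains these two pairs and no third one,
  so \<open>m \<ge> t (t - 1) / 2\<close>.  Hence a set of pairs at one distance has \<open>O(m\<^sup>3\<^sup>/\<^sup>2)\<close> elements as soon as
  pairs generating the same line are disjoint, and this is automatic for the distances 2 and 3.
  If a positive proportion of all pairs has distance 2 or 3, we are done.  Otherwise at least half of
  the points have few points at distance at least 2, so any two of these points have a common
  neighbour at distance 1, and the distance 3 does not occur among them.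

  In a space with distances 1 and 2, pairs \<open>ab\<close> and \<open>ac\<close> at distance 1 generate the same line only if
  \<open>b\<close> and \<open>c\<close> are twins (at distance 1 from the same points).  If there are linearly many
  twin classes, choose one point of each and apply the bound above to the pairs at distance 1.
  Otherwise most points have at least two twins; among these, pairs at distance 2 generate distinct
  lines, so there are only \<open>O(m)\<close> such pairs, and a point has on average \<open>\<Delta> = O(m / n)\<close> points at
  distance 2.  A line generated by a pair at distance 1 then has size \<open>O(\<Delta>)\<close>, so it is generated
  by \<open>O(\<Delta>\<^sup>2)\<close> pairs, whence \<open>n\<^sup>2 = O(m \<Delta>\<^sup>2) = O(m\<^sup>3 / n\<^sup>2)\<close>.

  For the upper bound take distance 2 inside blocks of size about \<open>n\<^sup>1\<^sup>/\<^sup>3\<close> and 1 between them.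
\<close>

section \<open>Counting\<close>

lemma card_le_fibers:
  fixes k :: real
  assumes "finite A" "finite B" "f ` A \<subseteq> B"
    and "\<And>y. y \<in> B \<Longrightarrow> real (card {x \<in> A. f x = y}) \<le> k"
  shows "real (card A) \<le> real (card B) * k"
proof -
  have "real (card A) = (\<Sum>y\<in>B. \<Sum>x\<in>{x \<in> A. f x = y}. 1)"
    using sum.group[OF assms(1-3), of "\<lambda>_. 1 :: real"] by simp
  also have "\<dots> = (\<Sum>y\<in>B. real (card {x \<in> A. f x = y}))" by simp
  also have "\<dots> \<le> real (card B) * k"
    using assms(4) by (rule sum_bounded_above)
  finally show ?thesis .
qed

lemma card_pairs_eq_sum:
  assumes "finite A"
  shows "card {(a, b) \<in> A \<times> A. R a b} = (\<Sum>a\<in>A. card {b \<in> A. R a b})"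
proof -
  have "{(a, b) \<in> A \<times> A. R a b} = (SIGMA a:A. {b \<in> A. R a b})" by auto
  then show ?thesis using assms by simp
qed

text \<open>Markov's inequality: \<open>K\<close> bounds the average of \<open>f\<close>, so at most
  half of the points exceed \<open>2 * K\<close>.\<close>

lemma card_low_degree_ge:
  fixes f :: "'a \<Rightarrow> nat" and K :: real
  assumes "finite V" "K > 0" "real (\<Sum>x\<in>V. f x) \<le> K * real (card V)"
  shows "real (card V) \<le> 2 * real (card {x \<in> V. real (f x) \<le> 2 * K})"
proof -
  let ?B = "{x \<in> V. \<not> real (f x) \<le> 2 * K}"
  have "real (card ?B) * (2 * K) = (\<Sum>x\<in>?B. 2 * K)" by simp
  also have "\<dots> \<le> (\<Sum>x\<in>?B. real (f x))" by (rule sum_mono) auto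
  also have "\<dots> \<le> (\<Sum>x\<in>V. real (f x))" using assms(1) by (intro sum_mono2) auto
  also have "\<dots> \<le> K * real (card V)" using assms(3) by simp
  finally have "K * (2 * real (card ?B)) \<le> K * real (card V)" by (simp add: algebra_simps)
  then have "2 * real (card ?B) \<le> real (card V)" using assms(2) by simp
  moreover have "card V = card {x \<in> V. real (f x) \<le> 2 * K} + card ?B"
    using assms(1) by (subst card_Un_disjoint[symmetric]) (auto intro: arg_cong[where f = card])
  ultimately show ?thesis by simp
qed

text \<open>Since \<open>2 t <= t^2 + 1\<close>, the bound \<open>t (t - 1) <= 2 k\<close> gives
  \<open>t^2 <= 4 k + 1 <= 5 k\<close>.\<close>

lemma le_sqrt_of_choose_2_le:
  assumes "t choose 2 \<le> k" "k \<ge> 1"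
  shows "real t \<le> sqrt (5 * real k)"
proof -
  have "2 * (t choose 2) = t * (t - 1)"
    unfolding choose_two by (rule dvd_mult_div_cancel) auto
  then have "t * (t - 1) \<le> 2 * k" using assms(1) by linarith
  then have "real (t * (t - 1)) \<le> real (2 * k)" by (rule of_nat_mono)
  then have "real t * (real t - 1) \<le> 2 * real k" by (cases t) (simp_all add: algebra_simps)
  moreover have "0 \<le> (real t - 1)\<^sup>2" by simp
  ultimately have "(real t)\<^sup>2 \<le> 5 * real k"
    using assms(2) by (simp add: power2_eq_square algebra_simps)
  then show ?thesis by (rule real_le_rsqrt)
qed

text \<open>Forgetting the order is at most two-to-one. Pairs are counted as ordered ones, whereas a
  line only sees its generators as an unordered pair.\<close>

lemma card_doubleton_image_ge:
  assumes "finite S"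
  shows "real (card S) \<le> 2 * real (card ((\<lambda>(a, b). {a, b}) ` S))"
proof -
  let ?f = "\<lambda>(a, b). {a, b}"
  have "real (card S) \<le> real (card (?f ` S)) * 2"
  proof (rule card_le_fibers[where f = ?f])
    fix y assume "y \<in> ?f ` S"
    then obtain a b where y: "y = {a, b}" by auto
    have "{x \<in> S. ?f x = y} \<subseteq> {(a, b), (b, a)}"
    proof
      fix x assume "x \<in> {x \<in> S. ?f x = y}"
      then obtain c d where "x = (c, d)" "{c, d} = {a, b}" using y by (cases x) simp
      then show "x \<in> {(a, b), (b, a)}" unfolding doubleton_eq_iff by blast
    qed
    then have "card {x \<in> S. ?f x = y} \<le> card {(a, b), (b, a)}"
      by (rule card_mono[rotated]) simp
    also have "\<dots> \<le> 2" using card_length[of "[(a, b), (b, a)]"] by simp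
    finally show "real (card {x \<in> S. ?f x = y}) \<le> 2" by linarith
  next
    show "finite S" "finite (?f ` S)" using assms by (auto intro: finite_imageI)
  qed (rule subset_refl)
  then show ?thesis by simp
qed

section \<open>Lines\<close>

context
  fixes V :: "'a set" and \<rho> :: "'a \<Rightarrow> 'a \<Rightarrow> real"
  assumes V: "three_metric_space V \<rho>"
begin

lemma finite_points: "finite V"
  using V unfolding three_metric_space_def by blast

lemma dist_sym: "\<rho> x y = \<rho> y x"
  using V unfolding three_metric_space_def by (metis Metric_space.commute)

lemma dist_zero: "x \<in> V \<Longrightarrow> y \<in> V \<Longrightarrow> \<rho> x y = 0 \<longleftrightarrow> x = y"
  using V unfolding three_metric_space_def by (metis Metric_space.zero)

lemma dist_tri: "x \<in> V \<Longrightarrow> y \<in> V \<Longrightarrow> z \<in> V \<Longrightarrow> \<rho> x z \<le> \<rho> x y + \<rho> y z"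
  using V unfolding three_metric_space_def by (metis Metric_space.triangle)

lemma dist_cases:
  assumes "x \<in> V" "y \<in> V" "x \<noteq> y"
  shows "\<rho> x y = 1 \<or> \<rho> x y = 2 \<or> \<rho> x y = 3"
proof -
  have "\<rho> x y \<ge> 0" "\<rho> x y \<noteq> 0" "\<rho> x y \<in> \<int>" "\<rho> x y \<le> 3"
    using V assms unfolding three_metric_space_def
    by (auto simp: Metric_space.nonneg Metric_space.zero)
  then obtain k where "\<rho> x y = of_int k" "k \<ge> 0" "k \<noteq> 0" "k \<le> 3"
    by (auto elim!: Ints_cases)
  then show ?thesis by (cases "k = 1"; cases "k = 2"; cases "k = 3") auto
qed

lemma line_commute: "line V \<rho> a b = line V \<rho> b a"
  unfolding line_def collinear_triple_def between_def
  by (auto simp: dist_sym add.commute)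

lemma line_subset: "a \<in> V \<Longrightarrow> b \<in> V \<Longrightarrow> line V \<rho> a b \<subseteq> V"
  unfolding line_def by auto

lemma line_in_lines: "a \<in> V \<Longrightarrow> b \<in> V \<Longrightarrow> a \<noteq> b \<Longrightarrow> line V \<rho> a b \<in> lines V \<rho>"
  unfolding lines_def by blast

lemma generators_in_line:
  shows "a \<in> line V \<rho> a b" and "a \<in> line V \<rho> b a"
  unfolding line_def by auto

lemma finite_lines: "finite (lines V \<rho>)"
  by (rule finite_subset[of _ "Pow V"]) (use line_subset finite_points in \<open>auto simp: lines_def\<close>)

section \<open>Distances in collinear triples\<close>

lemma mem_line_iff:
  assumes "a \<in> V" "b \<in> V" "c \<in> V" "a \<noteq> b" "c \<noteq> a" "c \<noteq> b"
  shows "c \<in> line V \<rho> a b \<longleftrightarrow>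
    \<rho> a c = \<rho> a b + \<rho> b c \<or> \<rho> a b = \<rho> a c + \<rho> b c \<or> \<rho> b c = \<rho> a b + \<rho> a c"
  using assms dist_sym[of b a] dist_sym[of c a] dist_sym[of c b]
  unfolding line_def collinear_triple_def between_def by auto

text \<open>The only sums within the set 1, 2, 3 are 1 + 1 = 2 and 1 + 2 = 3. This lemma and the
  next two read off the consequences for each distance of the generators.\<close>

lemma mem_line_1:
  assumes "a \<in> V" "b \<in> V" "c \<in> V" "\<rho> a b = 1" "c \<noteq> a" "c \<noteq> b"
  shows "c \<in> line V \<rho> a b \<longleftrightarrow>
    \<rho> a c = 2 \<and> (\<rho> b c = 1 \<or> \<rho> b c = 3) \<or> \<rho> b c = 2 \<and> (\<rho> a c = 1 \<or> \<rho> a c = 3)"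
proof -
  have "a \<noteq> b" "a \<noteq> c" "b \<noteq> c" using assms dist_zero[of a b] by auto
  with assms show ?thesis
    using dist_cases[of a c, OF assms(1,3) \<open>a \<noteq> c\<close>] dist_cases[of b c, OF assms(2,3) \<open>b \<noteq> c\<close>]
    by (elim disjE) (simp_all add: mem_line_iff)
qed

lemma mem_line_2:
  assumes "a \<in> V" "b \<in> V" "c \<in> V" "\<rho> a b = 2" "c \<noteq> a" "c \<noteq> b"
  shows "c \<in> line V \<rho> a b \<longleftrightarrow>
    \<rho> a c = 1 \<and> \<rho> b c = 1 \<or> \<rho> a c = 1 \<and> \<rho> b c = 3 \<or> \<rho> a c = 3 \<and> \<rho> b c = 1"
proof -
  have "a \<noteq> b" "a \<noteq> c" "b \<noteq> c" using assms dist_zero[of a b] by auto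
  with assms show ?thesis
    using dist_cases[of a c, OF assms(1,3) \<open>a \<noteq> c\<close>] dist_cases[of b c, OF assms(2,3) \<open>b \<noteq> c\<close>]
    by (elim disjE) (simp_all add: mem_line_iff)
qed

lemma mem_line_3:
  assumes "a \<in> V" "b \<in> V" "c \<in> V" "\<rho> a b = 3" "c \<noteq> a" "c \<noteq> b"
  shows "c \<in> line V \<rho> a b \<longleftrightarrow> \<rho> a c = 1 \<and> \<rho> b c = 2 \<or> \<rho> a c = 2 \<and> \<rho> b c = 1"
proof -
  have "a \<noteq> b" "a \<noteq> c" "b \<noteq> c" using assms dist_zero[of a b] by auto
  with assms show ?thesis
    using dist_cases[of a c, OF assms(1,3) \<open>a \<noteq> c\<close>] dist_cases[of b c, OF assms(2,3) \<open>b \<noteq> c\<close>]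
    by (elim disjE) (simp_all add: mem_line_iff)
qed

text \<open>Parity: the distances of a collinear triple are 1, 1, 2 or 1, 2, 3, so exactly one of
  them is 2. If the generators do not use it up, one of the other two distances has to be 2; if they
  do, neither is (\<open>mem_line_even\<close>).\<close>

lemma mem_line_odd:
  assumes "a \<in> V" "b \<in> V" "c \<in> V" "\<rho> a b = 1 \<or> \<rho> a b = 3" "c \<noteq> a" "c \<noteq> b" "c \<in> line V \<rho> a b"
  shows "\<rho> a c = 2 \<longleftrightarrow> \<rho> b c \<noteq> 2"
  using assms(4)
proof
  assume "\<rho> a b = 1"
  then show ?thesis using mem_line_1[OF assms(1-3) _ assms(5,6), THEN iffD1, OF _ assms(7)] by auto
next
  assume "\<rho> a b = 3"
  then show ?thesis using mem_line_3[OF assms(1-3) _ assms(5,6), THEN iffD1, OF _ assms(7)] by auto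
qed

lemma mem_line_even:
  assumes "a \<in> V" "b \<in> V" "c \<in> V" "\<rho> a b = 2" "c \<noteq> a" "c \<noteq> b" "c \<in> line V \<rho> a b"
  shows "\<rho> a c \<noteq> 2" "\<rho> b c \<noteq> 2"
  using mem_line_2[OF assms(1-6), THEN iffD1, OF assms(7)] by auto

text \<open>
  Given two disjoint pairs at distance \<open>\<delta>\<close> on a common line, a point of one and a point of the other
  at distance \<open>separating_dist \<delta>\<close> generate a line that contains both pairs and no third such pair.
\<close>
definition separating_dist :: "real \<Rightarrow> real" where
  "separating_dist \<delta> = (if \<delta> = 2 then 1 else 2)"

text \<open>A collinear triple contains both a 1 and a 2. The value
  \<open>separating_dist \<delta>\<close> is one of these and differs from \<open>\<delta>\<close>,
  so it occurs at a side through \<open>c\<close>.\<close>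

lemma cross_dist:
  assumes "a \<in> V" "b \<in> V" "c \<in> V" "c \<noteq> a" "c \<noteq> b" "a \<noteq> b" "\<rho> a b = \<delta>"
    and "c \<in> line V \<rho> a b"
  shows "\<rho> a c = separating_dist \<delta> \<or> \<rho> b c = separating_dist \<delta>"
proof -
  consider "\<delta> = 1" | "\<delta> = 2" | "\<delta> = 3" using dist_cases[of a b] assms by metis
  then show ?thesis
    unfolding separating_dist_def using assms mem_line_1 mem_line_2 mem_line_3
    by cases (metis (full_types))+
qed

text \<open>The two memberships reflect the symmetry of collinearity: \<open>c\<close> on the line
  \<open>ab\<close> puts \<open>b\<close> on the line \<open>ac\<close>, and \<open>a\<close> on the
  line \<open>cd\<close> puts \<open>d\<close> on it.\<close>

lemma separating_line_aux:
  assumes V: "a \<in> V" "b \<in> V" "c \<in> V" "d \<in> V"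
    and ab: "a \<noteq> b" "\<rho> a b = \<delta>" and cd: "c \<noteq> d" "\<rho> c d = \<delta>"
    and disj: "{a, b} \<inter> {c, d} = {}"
    and eq: "line V \<rho> a b = line V \<rho> c d"
    and ac: "\<rho> a c = separating_dist \<delta>"
  shows "b \<in> line V \<rho> a c" "d \<in> line V \<rho> a c"
    and "\<And>e f. e \<in> V \<Longrightarrow> f \<in> V \<Longrightarrow> e \<noteq> f \<Longrightarrow> \<rho> e f = \<delta> \<Longrightarrow> line V \<rho> e f = line V \<rho> a b
      \<Longrightarrow> {e, f} \<inter> {a, b, c, d} = {} \<Longrightarrow> \<not> {e, f} \<subseteq> line V \<rho> a c"
proof -
  have ne: "a \<noteq> c" "a \<noteq> d" "b \<noteq> c" "b \<noteq> d" using disj by auto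
  have mem: "a \<in> line V \<rho> c d" "b \<in> line V \<rho> c d" "c \<in> line V \<rho> a b" "d \<in> line V \<rho> a b"
    using eq generators_in_line by metis+
  have \<delta>: "\<delta> = 1 \<or> \<delta> = 2 \<or> \<delta> = 3" using dist_cases[of a b] V(1,2) ab by simp
  have cross: "\<rho> b c \<noteq> 2 \<and> \<rho> a d \<noteq> 2" if "\<delta> = 1"
    using mem_line_1[of a b c, THEN iffD1] mem_line_1[of c d a, THEN iffD1]
      V ab(2) cd(2) ne mem(1,3) ac that dist_sym[of c a] dist_sym[of d a]
    by (simp add: separating_dist_def) (smt (verit))
  show "b \<in> line V \<rho> a c"
    using \<delta>
  proof (elim disjE)
    assume 1: "\<delta> = 1"
    have "\<rho> b c = 1 \<or> \<rho> b c = 3" using cross 1 dist_cases[of b c] V ne by blast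
    then show ?thesis
      using mem_line_2[of a c b] V ab ne ac 1 dist_sym[of c b] by (simp add: separating_dist_def)
  next
    assume 2: "\<delta> = 2"
    have "\<rho> b c = 1 \<or> \<rho> b c = 3"
      using mem_line_2[of a b c, THEN iffD1] V ab(2) ne mem(3) 2 by blast
    then show ?thesis
      using mem_line_1[of a c b] V ab ne ac 2 dist_sym[of c b] by (simp add: separating_dist_def)
  next
    assume 3: "\<delta> = 3"
    have "\<rho> b c = 1"
      using mem_line_3[of a b c, THEN iffD1] V ab(2) ne mem(3) ac 3
      by (simp add: separating_dist_def)
    then show ?thesis
      using mem_line_2[of a c b] V ab ne ac 3 dist_sym[of c b] by (simp add: separating_dist_def)
  qed
  show "d \<in> line V \<rho> a c"
    using \<delta>
  proof (elim disjE)
    assume 1: "\<delta> = 1"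
    have "\<rho> a d = 1 \<or> \<rho> a d = 3" using cross 1 dist_cases[of a d] V ne by blast
    then show ?thesis
      using mem_line_2[of a c d] V cd ne ac 1 by (simp add: separating_dist_def)
  next
    assume 2: "\<delta> = 2"
    have "\<rho> d a = 1 \<or> \<rho> d a = 3"
      using mem_line_2[of c d a, THEN iffD1] V cd(2) ne mem(1) 2 by blast
    then show ?thesis
      using mem_line_1[of a c d] V cd ne ac 2 dist_sym[of d a] by (simp add: separating_dist_def)
  next
    assume 3: "\<delta> = 3"
    have "\<rho> d a = 1"
      using mem_line_3[of c d a, THEN iffD1] V cd(2) ne mem(1) ac 3 dist_sym[of c a]
      by (simp add: separating_dist_def)
    then show ?thesis
      using mem_line_2[of a c d] V cd ne ac 3 dist_sym[of d a] by (simp add: separating_dist_def)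
  qed
  fix e f
  assume e: "e \<in> V" "f \<in> V" "e \<noteq> f" "\<rho> e f = \<delta>" "line V \<rho> e f = line V \<rho> a b"
    and "{e, f} \<inter> {a, b, c, d} = {}"
  then have ne': "e \<noteq> a" "e \<noteq> c" "f \<noteq> a" "f \<noteq> c" by auto
  have mem': "a \<in> line V \<rho> e f" "c \<in> line V \<rho> e f"
    using e(5) mem eq generators_in_line[of a b] by auto
  note sym' = dist_sym[of a e] dist_sym[of a f] dist_sym[of c e]
  \<comment> \<open>Count the distances equal to 2. If \<open>\<delta> = 2\<close>, then
    \<open>a\<close> and \<open>c\<close> on the line \<open>ef\<close> exclude this value for
    \<open>ae\<close> and \<open>ce\<close>, but \<open>e\<close> on the line \<open>ac\<close>
    needs it at one of them. If \<open>\<delta>\<close> is odd, then \<open>e\<close> and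
    \<open>f\<close> on the line \<open>ac\<close> exclude it for \<open>ae\<close> and
    \<open>af\<close>, but \<open>a\<close> on the line \<open>ef\<close> needs it at one of
    them.\<close>
  show "\<not> {e, f} \<subseteq> line V \<rho> a c"
  proof
    assume "{e, f} \<subseteq> line V \<rho> a c"
    then have ef: "e \<in> line V \<rho> a c" "f \<in> line V \<rho> a c" by auto
    show False
    proof (cases "\<delta> = 2")
      case True
      then have "\<rho> e f = 2" "\<rho> a c = 1" using e(4) ac by (simp_all add: separating_dist_def)
      then show False
        using mem_line_even(1)[OF e(1,2) V(1) _ _ _ mem'(1)]
          mem_line_even(1)[OF e(1,2) V(3) _ _ _ mem'(2)]
          mem_line_odd[OF V(1,3) e(1) _ _ _ ef(1)] ne' sym' by fastforce
    next
      case False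
      then have "\<rho> e f = 1 \<or> \<rho> e f = 3" "\<rho> a c = 2"
        using e(4) ac \<delta> by (simp_all add: separating_dist_def)
      then show False
        using mem_line_odd[OF e(1,2) V(1) _ _ _ mem'(1)]
          mem_line_even(1)[OF V(1,3) e(1) _ _ _ ef(1)]
          mem_line_even(1)[OF V(1,3) e(2) _ _ _ ef(2)] ne' sym' by fastforce
    qed
  qed
qed

text \<open>By \<open>cross_dist\<close>, \<open>ac\<close> or \<open>bc\<close> has the separating
  distance; the second case is the first with \<open>a\<close> and \<open>b\<close>
  exchanged.\<close>

lemma separating_line:
  assumes V: "a \<in> V" "b \<in> V" "c \<in> V" "d \<in> V"
    and ab: "a \<noteq> b" "\<rho> a b = \<delta>" and cd: "c \<noteq> d" "\<rho> c d = \<delta>"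
    and disj: "{a, b} \<inter> {c, d} = {}"
    and eq: "line V \<rho> a b = line V \<rho> c d"
  obtains l where "l \<in> lines V \<rho>" "{a, b, c, d} \<subseteq> l"
    and "\<And>e f. e \<in> V \<Longrightarrow> f \<in> V \<Longrightarrow> e \<noteq> f \<Longrightarrow> \<rho> e f = \<delta> \<Longrightarrow> line V \<rho> e f = line V \<rho> a b
      \<Longrightarrow> {e, f} \<inter> {a, b, c, d} = {} \<Longrightarrow> \<not> {e, f} \<subseteq> l"
proof -
  have "c \<in> line V \<rho> a b" using eq generators_in_line by auto
  then have "\<rho> a c = separating_dist \<delta> \<or> \<rho> b c = separating_dist \<delta>"
    using cross_dist[of a b c \<delta>] V ab disj by auto
  then show thesis
  proof
    assume "\<rho> a c = separating_dist \<delta>"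
    note aux = separating_line_aux[OF V ab cd disj eq this]
    show thesis
    proof (rule that[of "line V \<rho> a c"])
      show "line V \<rho> a c \<in> lines V \<rho>" using V disj by (intro line_in_lines) auto
      show "{a, b, c, d} \<subseteq> line V \<rho> a c" using aux(1,2) generators_in_line by simp
    qed (rule aux(3))
  next
    assume bc: "\<rho> b c = separating_dist \<delta>"
    have ba: "b \<noteq> a" "\<rho> b a = \<delta>" "{b, a} \<inter> {c, d} = {}" "line V \<rho> b a = line V \<rho> c d"
      using ab dist_sym[of b a] disj eq line_commute[of b a] by auto
    note aux = separating_line_aux[OF V(2,1,3,4) ba(1,2) cd ba(3,4) bc]
    show thesis
    proof (rule that[of "line V \<rho> b c"])
      show "line V \<rho> b c \<in> lines V \<rho>" using V disj by (intro line_in_lines) auto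
      show "{a, b, c, d} \<subseteq> line V \<rho> b c" using aux(1,2) generators_in_line by simp
      show "\<not> {e, f} \<subseteq> line V \<rho> b c"
        if "e \<in> V" "f \<in> V" "e \<noteq> f" "\<rho> e f = \<delta>" "line V \<rho> e f = line V \<rho> a b"
          "{e, f} \<inter> {a, b, c, d} = {}" for e f
        using aux(3)[of e f] that line_commute[of a b] by (simp add: insert_commute)
    qed
  qed
qed

text \<open>Sending a line to the set of members of \<open>P\<close> inside it reaches every
  two-element subset of \<open>P\<close>: \<open>{p, q}\<close> comes from the line separating
  \<open>p\<close> and \<open>q\<close> from the rest.\<close>

lemma matching_choose_2_le:
  assumes P: "\<And>p. p \<in> P \<Longrightarrow> \<exists>a\<in>V. \<exists>b\<in>V. p = {a, b} \<and> a \<noteq> b \<and> \<rho> a b = \<delta> \<and> line V \<rho> a b = L"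
    and disj: "\<And>p q. p \<in> P \<Longrightarrow> q \<in> P \<Longrightarrow> p \<noteq> q \<Longrightarrow> p \<inter> q = {}"
  shows "card P choose 2 \<le> card (lines V \<rho>)"
proof -
  have "P \<subseteq> Pow V" using P by fastforce
  then have fin: "finite P" using finite_points finite_subset by blast
  let ?g = "\<lambda>l. {r \<in> P. r \<subseteq> l}"
  have "{X. X \<subseteq> P \<and> card X = 2} \<subseteq> ?g ` lines V \<rho>"
  proof
    fix X assume "X \<in> {X. X \<subseteq> P \<and> card X = 2}"
    then obtain p q where X: "X = {p, q}" and pq: "p \<in> P" "q \<in> P" "p \<noteq> q"
      by (auto simp: card_2_iff)
    obtain a b where ab: "a \<in> V" "b \<in> V" "p = {a, b}" "a \<noteq> b" "\<rho> a b = \<delta>" "line V \<rho> a b = L"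
      using P pq(1) by blast
    obtain c d where cd: "c \<in> V" "d \<in> V" "q = {c, d}" "c \<noteq> d" "\<rho> c d = \<delta>" "line V \<rho> c d = L"
      using P pq(2) by blast
    have "{a, b} \<inter> {c, d} = {}" using disj[OF pq] ab cd by simp
    with ab cd obtain l where l: "l \<in> lines V \<rho>" "{a, b, c, d} \<subseteq> l"
      and no: "\<And>e f. e \<in> V \<Longrightarrow> f \<in> V \<Longrightarrow> e \<noteq> f \<Longrightarrow> \<rho> e f = \<delta> \<Longrightarrow> line V \<rho> e f = line V \<rho> a b
        \<Longrightarrow> {e, f} \<inter> {a, b, c, d} = {} \<Longrightarrow> \<not> {e, f} \<subseteq> l"
      using separating_line[of a b c d \<delta>] by metis
    have "r = p \<or> r = q" if "r \<in> P" "r \<subseteq> l" for r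
    proof (rule ccontr)
      assume "\<not> (r = p \<or> r = q)"
      then have "r \<inter> p = {}" "r \<inter> q = {}" using disj that(1) pq by auto
      then have "r \<inter> {a, b, c, d} = {}" using ab cd by auto
      then show False using P[OF that(1)] no that(2) ab(6) by metis
    qed
    then have "?g l = X" using l(2) X ab cd pq by auto
    then show "X \<in> ?g ` lines V \<rho>" using l(1) by blast
  qed
  then have "card {X. X \<subseteq> P \<and> card X = 2} \<le> card (?g ` lines V \<rho>)"
    by (intro card_mono) (auto simp: finite_lines)
  also have "\<dots> \<le> card (lines V \<rho>)" by (rule card_image_le) (rule finite_lines)
  finally show ?thesis using n_subsets[OF fin, of 2] by simp
qed

text \<open>By \<open>star\<close>, pairs of \<open>S\<close> with a common line are equal or
  disjoint. With \<open>m\<close> lines in all, each comes from at most \<open>sqrt (5 m)\<close>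
  unordered pairs, so \<open>S\<close> has at most \<open>2 m sqrt (5 m)\<close> elements.\<close>

lemma card_pairs_le:
  assumes S: "S \<subseteq> V \<times> V" "\<And>a b. (a, b) \<in> S \<Longrightarrow> a \<noteq> b \<and> \<rho> a b = \<delta>"
    and sym: "\<And>a b. (a, b) \<in> S \<Longrightarrow> (b, a) \<in> S"
    and star: "\<And>a b c. (a, b) \<in> S \<Longrightarrow> (a, c) \<in> S \<Longrightarrow> line V \<rho> a b = line V \<rho> a c \<Longrightarrow> b = c"
  shows "(real (card S))\<^sup>2 \<le> 20 * real (card (lines V \<rho>)) ^ 3"
proof (cases "S = {}")
  case False
  define m where "m = real (card (lines V \<rho>))"
  have finS: "finite S" using finite_subset[OF S(1)] finite_points by simp
  obtain a b where "(a, b) \<in> S" using False by auto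
  then have "line V \<rho> a b \<in> lines V \<rho>" using S(1) S(2)[of a b] by (intro line_in_lines) auto
  then have "lines V \<rho> \<noteq> {}" by blast
  then have m: "m \<ge> 1" unfolding m_def using finite_lines
    by (simp add: Suc_le_eq card_gt_0_iff)
  have disj: "{a, b} = {c, d} \<or> {a, b} \<inter> {c, d} = {}"
    if ab: "(a, b) \<in> S" and cd: "(c, d) \<in> S" and eq: "line V \<rho> a b = line V \<rho> c d" for a b c d
  proof -
    \<comment> \<open>\<open>star\<close> speaks of a common first entry; swapping the entries of
      either pair moves any common point there.\<close>
    have eqs: "line V \<rho> a b = line V \<rho> d c" "line V \<rho> b a = line V \<rho> c d" "line V \<rho> b a = line V \<rho> d c"
      using eq line_commute by metis+
    have "a = c \<Longrightarrow> b = d" "a = d \<Longrightarrow> b = c" "b = c \<Longrightarrow> a = d" "b = d \<Longrightarrow> a = c"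
      using star[OF ab, of d] star[OF ab, of c] star[OF sym[OF ab], of d] star[OF sym[OF ab], of c]
        cd sym[OF cd] eq eqs by metis+
    then show ?thesis by blast
  qed
  have fiber: "real (card {x \<in> S. (case x of (a, b) \<Rightarrow> line V \<rho> a b) = L}) \<le> 2 * sqrt (5 * m)" for L
  proof -
    let ?F = "{x \<in> S. (case x of (a, b) \<Rightarrow> line V \<rho> a b) = L}"
    let ?P = "(\<lambda>(a, b). {a, b}) ` ?F"
    have "card ?P choose 2 \<le> card (lines V \<rho>)"
    proof (rule matching_choose_2_le[where \<delta> = \<delta> and L = L])
      fix p assume "p \<in> ?P"
      then obtain a b where ab: "(a, b) \<in> S" "p = {a, b}" "line V \<rho> a b = L" by auto
      then have "a \<in> V" "b \<in> V" using S(1) by auto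
      then show "\<exists>a\<in>V. \<exists>b\<in>V. p = {a, b} \<and> a \<noteq> b \<and> \<rho> a b = \<delta> \<and> line V \<rho> a b = L"
        using ab S(2)[OF ab(1)] by (intro bexI[of _ a] bexI[of _ b]) simp_all
    next
      fix p q assume pq: "p \<in> ?P" "q \<in> ?P" "p \<noteq> q"
      then obtain a b c d where "(a, b) \<in> S" "(c, d) \<in> S" "line V \<rho> a b = L" "line V \<rho> c d = L"
        "p = {a, b}" "q = {c, d}" by auto
      then show "p \<inter> q = {}" using disj[of a b c d] pq(3) by simp
    qed
    then have "real (card ?P) \<le> sqrt (5 * m)"
      using m unfolding m_def by (intro le_sqrt_of_choose_2_le) simp_all
    then show ?thesis using card_doubleton_image_ge[of ?F] finS by simp
  qed
  have "(\<lambda>(a, b). line V \<rho> a b) ` S \<subseteq> lines V \<rho>"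
  proof (safe)
    fix a b assume "(a, b) \<in> S"
    then show "line V \<rho> a b \<in> lines V \<rho>" using S(1) S(2)[of a b] by (intro line_in_lines) auto
  qed
  then have "real (card S) \<le> real (card (lines V \<rho>)) * (2 * sqrt (5 * m))"
    by (rule card_le_fibers[OF finS finite_lines _ fiber])
  then have "(real (card S))\<^sup>2 \<le> (m * (2 * sqrt (5 * m)))\<^sup>2"
    unfolding m_def by (intro power_mono) auto
  also have "\<dots> = 20 * m ^ 3"
    using m unfolding power_mult_distrib by (simp add: power2_eq_square power3_eq_cube)
  finally show ?thesis unfolding m_def .
qed simp

text \<open>Otherwise \<open>a\<close>, \<open>b\<close>, \<open>c\<close> would be collinear with
  \<open>\<delta>\<close> occurring twice, but only the distance 1 can be repeated in a collinear
  triple.\<close>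

lemma same_line_same_dist:
  assumes "a \<in> V" "b \<in> V" "c \<in> V" "\<rho> a b = \<delta>" "\<rho> a c = \<delta>" "\<delta> = 2 \<or> \<delta> = 3"
    and "line V \<rho> a b = line V \<rho> a c"
  shows "b = c"
proof (rule ccontr)
  assume "b \<noteq> c"
  moreover have "a \<noteq> b" "c \<noteq> a"
    using assms(4-6) dist_zero[OF assms(1,2)] dist_zero[OF assms(1,3)] by (elim disjE; simp)+
  moreover have "c \<in> line V \<rho> a b" unfolding assms(7) by (rule generators_in_line)
  ultimately show False
    using mem_line_2[OF assms(1-3), THEN iffD1] mem_line_3[OF assms(1-3), THEN iffD1]
      assms(4-6) by fastforce
qed

lemma card_pairs_far_le:
  assumes "\<delta> = 2 \<or> \<delta> = 3"
  shows "(real (card {(a, b) \<in> V \<times> V. \<rho> a b = \<delta>}))\<^sup>2 \<le> 20 * real (card (lines V \<rho>)) ^ 3"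
proof (rule card_pairs_le[where \<delta> = \<delta>])
  show "a \<noteq> b \<and> \<rho> a b = \<delta>" if "(a, b) \<in> {(a, b) \<in> V \<times> V. \<rho> a b = \<delta>}" for a b
    using that assms dist_zero[of a b] by (elim disjE) simp_all
  show "b = c"
    if "(a, b) \<in> {(a, b) \<in> V \<times> V. \<rho> a b = \<delta>}" "(a, c) \<in> {(a, b) \<in> V \<times> V. \<rho> a b = \<delta>}"
      "line V \<rho> a b = line V \<rho> a c" for a b c
    using same_line_same_dist[of a b c \<delta>] that assms by blast
qed (auto simp: dist_sym)

section \<open>Passing to a subspace\<close>

lemma three_metric_space_subset: "W \<subseteq> V \<Longrightarrow> three_metric_space W \<rho>"
  using V Metric_space.subspace[of V \<rho> W] finite_subset[of W V]
  unfolding three_metric_space_def by auto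

text \<open>Each line of \<open>W\<close> is the trace on \<open>W\<close> of the line of
  \<open>V\<close> with the same generators.\<close>

lemma card_lines_mono:
  assumes "W \<subseteq> V"
  shows "card (lines W \<rho>) \<le> card (lines V \<rho>)"
proof -
  have restrict: "line W \<rho> a b = line V \<rho> a b \<inter> W" if "a \<in> W" "b \<in> W" for a b
    using assms that unfolding line_def by auto
  have "lines W \<rho> \<subseteq> (\<lambda>l. l \<inter> W) ` lines V \<rho>"
  proof
    fix l assume "l \<in> lines W \<rho>"
    then obtain a b where "a \<in> W" "b \<in> W" "a \<noteq> b" "l = line W \<rho> a b"
      unfolding lines_def by blast
    then show "l \<in> (\<lambda>l. l \<inter> W) ` lines V \<rho>"
      using restrict assms by (intro image_eqI[of _ _ "line V \<rho> a b"] line_in_lines) auto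
  qed
  then have "card (lines W \<rho>) \<le> card ((\<lambda>l. l \<inter> W) ` lines V \<rho>)"
    by (intro card_mono) (auto simp: finite_lines)
  also have "\<dots> \<le> card (lines V \<rho>)" by (rule card_image_le) (rule finite_lines)
  finally show ?thesis .
qed

end

section \<open>Lower bound\<close>

text \<open>Contains \<open>a\<close> itself, which is at distance 0. So points of \<open>V\<close>
  with equal sets are never at distance 1, and equality of these sets is the twin relation.\<close>

definition nonadjacent :: "'a set \<Rightarrow> ('a \<Rightarrow> 'a \<Rightarrow> real) \<Rightarrow> 'a \<Rightarrow> 'a set" where
  "nonadjacent V \<rho> a = {z \<in> V. \<rho> a z \<noteq> 1}"

lemma card_adjacent_pairs_ge:
  assumes "finite U" "U \<subseteq> V" "finite V"
    and "\<And>a. a \<in> U \<Longrightarrow> real (card (nonadjacent V \<rho> a)) \<le> d"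
  shows "real (card U) * (real (card U) - d) \<le> real (card {(a, b) \<in> U \<times> U. \<rho> a b = 1})"
proof -
  have "real (card U) - d \<le> real (card {b \<in> U. \<rho> a b = 1})" if "a \<in> U" for a
  proof -
    have "U \<subseteq> {b \<in> U. \<rho> a b = 1} \<union> nonadjacent V \<rho> a"
      using assms(2) unfolding nonadjacent_def by auto
    then have "card U \<le> card ({b \<in> U. \<rho> a b = 1} \<union> nonadjacent V \<rho> a)"
      using assms(1,3) by (intro card_mono) (auto simp: nonadjacent_def)
    also have "\<dots> \<le> card {b \<in> U. \<rho> a b = 1} + card (nonadjacent V \<rho> a)" by (rule card_Un_le)
    finally show ?thesis using assms(4)[OF that] by linarith
  qed
  then have "(\<Sum>a\<in>U. real (card U) - d) \<le> (\<Sum>a\<in>U. real (card {b \<in> U. \<rho> a b = 1}))"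
    by (rule sum_mono)
  then show ?thesis unfolding card_pairs_eq_sum[OF assms(1)] by simp
qed

section \<open>Spaces with distances 1 and 2 only\<close>

context
  fixes W :: "'a set" and \<rho> :: "'a \<Rightarrow> 'a \<Rightarrow> real"
  assumes W: "three_metric_space W \<rho>"
    and diam: "\<And>x y. x \<in> W \<Longrightarrow> y \<in> W \<Longrightarrow> \<rho> x y \<le> 2"
begin

lemma dist_cases_2: "x \<in> W \<Longrightarrow> y \<in> W \<Longrightarrow> x \<noteq> y \<Longrightarrow> \<rho> x y = 1 \<or> \<rho> x y = 2"
  using dist_cases[OF W, of x y] diam[of x y] by linarith

lemma dist_self: "x \<in> W \<Longrightarrow> \<rho> x x = 0"
  using dist_zero[OF W] by blast

lemma mem_line_1_diam_2:
  assumes "a \<in> W" "b \<in> W" "c \<in> W" "\<rho> a b = 1" "c \<noteq> a" "c \<noteq> b"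
  shows "c \<in> line W \<rho> a b \<longleftrightarrow> (\<rho> a c = 1 \<longleftrightarrow> \<rho> b c \<noteq> 1)"
  using mem_line_1[OF W assms] dist_cases_2[OF assms(1,3) assms(5)[symmetric]]
    dist_cases_2[OF assms(2,3) assms(6)[symmetric]] by (elim disjE) simp_all

lemma mem_line_2_diam_2:
  assumes "a \<in> W" "b \<in> W" "c \<in> W" "\<rho> a b = 2" "c \<noteq> a" "c \<noteq> b"
  shows "c \<in> line W \<rho> a b \<longleftrightarrow> \<rho> a c = 1 \<and> \<rho> b c = 1"
  using mem_line_2[OF W assms] dist_cases_2[OF assms(1,3) assms(5)[symmetric]]
    dist_cases_2[OF assms(2,3) assms(6)[symmetric]] by (elim disjE) simp_all

lemma nonadjacent_iff: "z \<in> W \<Longrightarrow> z \<in> nonadjacent W \<rho> a \<longleftrightarrow> \<rho> a z \<noteq> 1"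
  unfolding nonadjacent_def by simp

text \<open>For \<open>z\<close> other than \<open>a\<close>, \<open>b\<close>, \<open>c\<close>,
  the line \<open>ab\<close> together with the distance \<open>az\<close> decides whether
  \<open>bz\<close> is 1, and the line \<open>ac\<close> decides in the same way whether
  \<open>cz\<close> is 1. That \<open>c\<close> lies on the line \<open>ab\<close> excludes distance
  1 between \<open>b\<close> and \<open>c\<close>.\<close>

lemma same_line_twins:
  assumes V: "a \<in> W" "b \<in> W" "c \<in> W" and 1: "\<rho> a b = 1" "\<rho> a c = 1"
    and eq: "line W \<rho> a b = line W \<rho> a c"
  shows "nonadjacent W \<rho> b = nonadjacent W \<rho> c"
proof (cases "b = c")
  case False
  have ne: "b \<noteq> a" "c \<noteq> a" using 1 V dist_self by auto
  have "c \<in> line W \<rho> a b" unfolding eq by (rule generators_in_line[OF W])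
  then have bc: "\<rho> b c \<noteq> 1" using mem_line_1_diam_2[OF V 1(1)] ne False 1 by auto
  have "\<rho> b z = 1 \<longleftrightarrow> \<rho> c z = 1" if z: "z \<in> W" for z
  proof -
    consider "z = a" | "z = b" | "z = c" | "z \<noteq> a" "z \<noteq> b" "z \<noteq> c" by blast
    then show ?thesis
    proof cases
      case 1
      then show ?thesis using \<open>\<rho> a b = 1\<close> \<open>\<rho> a c = 1\<close> dist_sym[OF W, of a b] dist_sym[OF W, of a c]
        by simp
    next
      case 2
      then show ?thesis using bc dist_self[OF V(2)] dist_sym[OF W, of b c] by simp
    next
      case 3
      then show ?thesis using bc dist_self[OF V(3)] by simp
    next
      case 4
      then show ?thesis
        using mem_line_1_diam_2[OF V(1,2) z 1(1)] mem_line_1_diam_2[OF V(1,3) z 1(2)] eq by blast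
    qed
  qed
  then show ?thesis unfolding nonadjacent_def by auto
qed simp

text \<open>A third twin \<open>a'\<close> of \<open>a\<close> misses the line \<open>ab\<close>, but would lie on the line \<open>cd\<close> if \<open>c, d\<close> were new.\<close>
lemma line_determines_twin_pair:
  assumes V: "a \<in> W" "b \<in> W" "c \<in> W" "d \<in> W" and 2: "\<rho> a b = 2" "\<rho> c d = 2"
    and eq: "line W \<rho> a b = line W \<rho> c d"
    and twin: "a' \<in> W" "nonadjacent W \<rho> a' = nonadjacent W \<rho> a" "a' \<noteq> a" "a' \<noteq> b"
  shows "{a, b} = {c, d}"
proof -
  have two': "\<rho> b a = 2" "\<rho> d c = 2"
    using 2 dist_sym[OF W, of a b] dist_sym[OF W, of c d] by simp_all
  have eqs: "line W \<rho> a b = line W \<rho> d c" "line W \<rho> b a = line W \<rho> c d" "line W \<rho> b a = line W \<rho> d c"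
    using eq line_commute[OF W] by metis+
  have meet: "a = c \<Longrightarrow> b = d" "a = d \<Longrightarrow> b = c" "b = c \<Longrightarrow> a = d" "b = d \<Longrightarrow> a = c"
    using same_line_same_dist[OF W V(1,2,4) 2(1)] same_line_same_dist[OF W V(1,2,3) 2(1)]
      same_line_same_dist[OF W V(2,1,4) two'(1)] same_line_same_dist[OF W V(2,1,3) two'(1)]
      2 two' eq eqs by metis+
  have False if ne: "a \<noteq> c" "a \<noteq> d" "b \<noteq> c" "b \<noteq> d"
  proof -
    have "c \<in> line W \<rho> a b" "d \<in> line W \<rho> a b" unfolding eq by (rule generators_in_line[OF W])+
    then have "\<rho> a c = 1" "\<rho> a d = 1"
      using mem_line_2_diam_2[OF V(1-3) 2(1)] mem_line_2_diam_2[OF V(1,2,4) 2(1)] ne by auto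
    then have cd: "\<rho> a' c = 1" "\<rho> a' d = 1"
      using twin(2) nonadjacent_iff[OF V(3)] nonadjacent_iff[OF V(4)] by blast+
    moreover have "a' \<noteq> c" "a' \<noteq> d" using cd dist_self[OF twin(1)] by auto
    ultimately have "a' \<in> line W \<rho> c d"
      using mem_line_2_diam_2[OF V(3,4) twin(1) 2(2)] dist_sym[OF W, of c a'] dist_sym[OF W, of d a']
      by simp
    then have "\<rho> a a' = 1"
      using mem_line_2_diam_2[OF V(1,2) twin(1) 2(1)] twin(3,4) eq by simp
    then show False
      using twin(2) nonadjacent_iff[OF twin(1)] dist_self[OF twin(1)] by force
  qed
  then show ?thesis using meet by blast
qed

lemma lines_ge_of_many_twin_classes:
  assumes few: "\<And>a. a \<in> W \<Longrightarrow> 16 * real (card (nonadjacent W \<rho> a)) \<le> real (card W)"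
    and many: "real (card W) \<le> 8 * real (card (nonadjacent W \<rho> ` W))"
  shows "real (card W) ^ 4 \<le> 400000 * real (card (lines W \<rho>)) ^ 3"
proof -
  define N where "N = real (card W)"
  have fin: "finite W" by (rule finite_points[OF W])
  \<comment> \<open>One point of each twin class. By \<open>same_line_twins\<close> this secures the
    hypothesis \<open>star\<close> of \<open>card_pairs_le\<close>, which can fail for distance
    1.\<close>
  obtain U where U: "U \<subseteq> W" "inj_on (nonadjacent W \<rho>) U"
    "nonadjacent W \<rho> ` U = nonadjacent W \<rho> ` W"
    using subset_image_inj[of "nonadjacent W \<rho> ` W" "nonadjacent W \<rho>" W] by auto
  let ?S = "{(a, b) \<in> U \<times> U. \<rho> a b = 1}"
  have cardU: "N / 8 \<le> real (card U)"
    using many card_image[OF U(2)] U(3) unfolding N_def by simp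
  have "(real (card ?S))\<^sup>2 \<le> 20 * real (card (lines W \<rho>)) ^ 3"
  proof (rule card_pairs_le[OF W, where \<delta> = 1])
    show "?S \<subseteq> W \<times> W" using U(1) by auto
    show "a \<noteq> b \<and> \<rho> a b = 1" if "(a, b) \<in> ?S" for a b
      using that dist_self[of a] U(1) by auto
    show "(b, a) \<in> ?S" if "(a, b) \<in> ?S" for a b
      using that dist_sym[OF W, of b a] by simp
    show "b = c" if "(a, b) \<in> ?S" "(a, c) \<in> ?S" "line W \<rho> a b = line W \<rho> a c" for a b c
      using inj_onD[OF U(2) same_line_twins[of a b c]] that U(1) by blast
  qed
  moreover have "N\<^sup>2 / 128 \<le> real (card ?S)"
  proof -
    \<comment> \<open>Each of at least \<open>N / 8\<close> representatives misses at most
      \<open>N / 16\<close> others.\<close>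
    have "N\<^sup>2 / 128 = (N / 8) * (N / 8 - N / 16)" by (simp add: power2_eq_square)
    also have "\<dots> \<le> real (card U) * (real (card U) - N / 16)"
      using cardU by (intro mult_mono) (auto simp: N_def)
    also have "\<dots> \<le> real (card ?S)"
    proof (rule card_adjacent_pairs_ge[OF finite_subset[OF U(1) fin] U(1) fin])
      show "real (card (nonadjacent W \<rho> a)) \<le> N / 16" if "a \<in> U" for a
        using few[of a] that U(1) unfolding N_def by auto
    qed
    finally show ?thesis .
  qed
  then have "(N\<^sup>2 / 128)\<^sup>2 \<le> (real (card ?S))\<^sup>2" by (intro power_mono) auto
  ultimately have "(N\<^sup>2 / 128)\<^sup>2 \<le> 20 * real (card (lines W \<rho>)) ^ 3" by linarith
  moreover have "(N\<^sup>2 / 128)\<^sup>2 = N ^ 4 / 16384"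
    by (simp add: power_divide flip: power_mult)
  moreover have "0 \<le> real (card (lines W \<rho>)) ^ 3" by simp
  \<comment> \<open>The constant is 20 * 16384 = 327680, rounded up.\<close>
  ultimately show ?thesis unfolding N_def by linarith
qed

lemma lines_ge_of_few_twin_classes:
  assumes few: "\<And>a. a \<in> W \<Longrightarrow> 16 * real (card (nonadjacent W \<rho> a)) \<le> real (card W)"
    and classes: "8 * real (card (nonadjacent W \<rho> ` W)) \<le> real (card W)"
    and nonempty: "W \<noteq> {}"
  shows "real (card W) ^ 4 \<le> 400000 * real (card (lines W \<rho>)) ^ 3"
proof -
  define N where "N = real (card W)"
  define m where "m = real (card (lines W \<rho>))"
  have fin: "finite W" by (rule finite_points[OF W])
  have N: "N > 0" unfolding N_def using nonempty fin by (simp add: card_gt_0_iff)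
  define twins where "twins = (\<lambda>a. {x \<in> W. nonadjacent W \<rho> x = nonadjacent W \<rho> a})"
  \<comment> \<open>\<open>twins a\<close> contains \<open>a\<close>, so the threshold 3 asks for
    two further twins.\<close>
  define T where "T = {a \<in> W. card (twins a) \<ge> 3}"
  have TW: "T \<subseteq> W" and finT: "finite T" using fin unfolding T_def by auto
  \<comment> \<open>A class that meets \<open>W - T\<close> has at most two points, and there are at
    most \<open>N / 8\<close> classes, so at most a quarter of \<open>W\<close> is lost.\<close>
  have "real (card (W - T)) \<le> real (card (nonadjacent W \<rho> ` W)) * 2"
  proof (rule card_le_fibers[where f = "nonadjacent W \<rho>"])
    fix y assume "y \<in> nonadjacent W \<rho> ` W"
    show "real (card {x \<in> W - T. nonadjacent W \<rho> x = y}) \<le> 2"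
    proof (cases "{x \<in> W - T. nonadjacent W \<rho> x = y} = {}")
      case True
      show ?thesis unfolding True by simp
    next
      case False
      then obtain a where a: "a \<in> W" "a \<notin> T" "nonadjacent W \<rho> a = y" by blast
      then have "{x \<in> W - T. nonadjacent W \<rho> x = y} \<subseteq> twins a" unfolding twins_def by auto
      then have "card {x \<in> W - T. nonadjacent W \<rho> x = y} \<le> card (twins a)"
        using fin by (intro card_mono) (auto simp: twins_def)
      also have "\<dots> \<le> 2" using a unfolding T_def by simp
      finally show ?thesis by simp
    qed
  qed (use fin in auto)
  moreover have "card W = card T + card (W - T)"
    using card_Diff_subset[OF finT TW] card_mono[OF fin TW] by simp
  ultimately have cardT: "3 / 4 * N \<le> real (card T)" using classes unfolding N_def by simp
  then have Tpos: "real (card T) > 0" using N by linarith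
  have twins_in_T: "twins a \<subseteq> T" if "a \<in> T" for a
    using that unfolding T_def twins_def by auto
  have other_twin: "\<exists>a'\<in>W. nonadjacent W \<rho> a' = nonadjacent W \<rho> a \<and> a' \<noteq> a \<and> a' \<noteq> b"
    if "a \<in> T" for a b
  proof -
    have "\<not> twins a \<subseteq> {a, b}"
    proof
      assume "twins a \<subseteq> {a, b}"
      then have "card (twins a) \<le> card {a, b}" by (intro card_mono) auto
      also have "\<dots> \<le> 2" using card_length[of "[a, b]"] by simp
      finally show False using that unfolding T_def by simp
    qed
    then show ?thesis unfolding twins_def by blast
  qed
  let ?S = "{(a, b) \<in> T \<times> T. \<rho> a b = 2}"
  have "real (card ?S) \<le> 2 * real (card ((\<lambda>(a, b). {a, b}) ` ?S))"
    using finT by (intro card_doubleton_image_ge) (auto intro: finite_subset[of _ "T \<times> T"])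
  also have "real (card ((\<lambda>(a, b). {a, b}) ` ?S)) \<le> m"
  proof -
    \<comment> \<open>\<open>g\<close> recovers the generating pair of \<open>?S\<close> from its
      line, uniquely by \<open>line_determines_twin_pair\<close>; its value at lines without such a
      pair does not matter.\<close>
    define g where "g = (\<lambda>l. (THE p. \<exists>a b. (a, b) \<in> ?S \<and> l = line W \<rho> a b \<and> p = {a, b}))"
    have "(\<lambda>(a, b). {a, b}) ` ?S \<subseteq> g ` lines W \<rho>"
    proof
      fix p assume "p \<in> (\<lambda>(a, b). {a, b}) ` ?S"
      then obtain a b where ab: "(a, b) \<in> ?S" "p = {a, b}" by auto
      then have V: "a \<in> T" "b \<in> T" "a \<in> W" "b \<in> W" "\<rho> a b = 2" using TW by auto
      then have "a \<noteq> b" using dist_self[of a] by auto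
      have "g (line W \<rho> a b) = p"
        unfolding g_def
      proof (rule the_equality)
        show "\<exists>c d. (c, d) \<in> ?S \<and> line W \<rho> a b = line W \<rho> c d \<and> p = {c, d}" using ab by blast
      next
        fix q assume "\<exists>c d. (c, d) \<in> ?S \<and> line W \<rho> a b = line W \<rho> c d \<and> q = {c, d}"
        then obtain c d where cd: "(c, d) \<in> ?S" "line W \<rho> a b = line W \<rho> c d" "q = {c, d}" by blast
        then have "c \<in> W" "d \<in> W" "\<rho> c d = 2" using TW by auto
        then show "q = p"
          using other_twin[OF V(1), of b] line_determines_twin_pair[of a b c d] V cd(2,3) ab(2) by metis
      qed
      then show "p \<in> g ` lines W \<rho>"
        using line_in_lines[OF W, of a b] V \<open>a \<noteq> b\<close> by blast
    qed
    then have "card ((\<lambda>(a, b). {a, b}) ` ?S) \<le> card (g ` lines W \<rho>)"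
      using finite_lines[OF W] by (intro card_mono) auto
    also have "\<dots> \<le> card (lines W \<rho>)" by (rule card_image_le[OF finite_lines[OF W]])
    finally show ?thesis unfolding m_def by simp
  qed
  finally have S_le: "real (card ?S) \<le> 2 * m" by simp
  \<comment> \<open>Again \<open>a\<close> itself is counted, which gives the summand
    \<open>card T\<close> in \<open>sum_deg\<close>.\<close>
  define deg where "deg = (\<lambda>a. card {b \<in> T. \<rho> a b \<noteq> 1})"
  have "deg a = Suc (card {b \<in> T. \<rho> a b = 2})" if "a \<in> T" for a
  proof -
    have "a \<in> W" using that TW by auto
    have "{b \<in> T. \<rho> a b \<noteq> 1} = insert a {b \<in> T. \<rho> a b = 2}"
      using dist_cases_2[OF \<open>a \<in> W\<close>] dist_self[OF \<open>a \<in> W\<close>] TW that by force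
    then show ?thesis unfolding deg_def using finT dist_self[OF \<open>a \<in> W\<close>] by simp
  qed
  then have "(\<Sum>a\<in>T. deg a) = (\<Sum>a\<in>T. Suc (card {b \<in> T. \<rho> a b = 2}))"
    by (rule sum.cong[OF refl])
  then have sum_deg: "(\<Sum>a\<in>T. deg a) = card T + card ?S"
    unfolding card_pairs_eq_sum[OF finT] sum_Suc by simp
  have "3 \<le> deg a" if "a \<in> T" for a
  proof -
    have "twins a \<subseteq> {b \<in> T. \<rho> a b \<noteq> 1}"
    proof
      fix b assume b: "b \<in> twins a"
      then have bW: "b \<in> W" and same: "nonadjacent W \<rho> b = nonadjacent W \<rho> a"
        unfolding twins_def by auto
      have "b \<in> nonadjacent W \<rho> b" using bW by (simp add: nonadjacent_def dist_self)
      then have "\<rho> a b \<noteq> 1" using nonadjacent_iff[OF bW, of a] same by simp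
      then show "b \<in> {b \<in> T. \<rho> a b \<noteq> 1}" using twins_in_T[OF that] b by auto
    qed
    then have "card (twins a) \<le> deg a" unfolding deg_def using finT by (intro card_mono) auto
    then show ?thesis using that unfolding T_def by simp
  qed
  then have "(\<Sum>a\<in>T. 3) \<le> (\<Sum>a\<in>T. deg a)" by (rule sum_mono)
  \<comment> \<open>From \<open>3 |T| <= |T| + |?S| <= |T| + 2 m\<close>. So the self-counts are
    absorbed and the degree sum is at most \<open>3 m\<close>.\<close>
  then have "real (card T) \<le> m" using S_le sum_deg by simp
  then have m: "m > 0" and sum_deg_le: "real (\<Sum>a\<in>T. deg a) \<le> 3 * m"
    using S_le sum_deg Tpos by simp_all
  \<comment> \<open>Twice the bound \<open>3 m / |T|\<close> on the average degree, as in
    \<open>card_low_degree_ge\<close>.\<close>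
  define D where "D = 6 * m / real (card T)"
  define T' where "T' = {a \<in> T. real (deg a) \<le> D}"
  have T'W: "T' \<subseteq> W" and finT': "finite T'" using TW finT unfolding T'_def by auto
  have "real (card T) \<le> 2 * real (card {a \<in> T. real (deg a) \<le> 2 * (3 * m / real (card T))})"
    using finT m Tpos sum_deg_le by (intro card_low_degree_ge) auto
  then have cardT': "3 / 8 * N \<le> real (card T')"
    using cardT unfolding T'_def D_def by simp
  let ?S' = "{(a, b) \<in> T' \<times> T'. \<rho> a b = 1}"
  have T'_space: "three_metric_space T' \<rho>" by (rule three_metric_space_subset[OF W T'W])
  \<comment> \<open>A point on the line of a pair at distance 1 is not at distance 1 from both
    generators, so the line has at most \<open>2 D\<close> points; all pairs generating it lie
    inside it. Lines are taken in \<open>T'\<close> since \<open>deg\<close> counts points of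
    \<open>T\<close> only.\<close>
  have fiber: "real (card {x \<in> ?S'. (case x of (a, b) \<Rightarrow> line T' \<rho> a b) = l}) \<le> (2 * D)\<^sup>2" for l
  proof (cases "{x \<in> ?S'. (case x of (a, b) \<Rightarrow> line T' \<rho> a b) = l} = {}")
    case True
    show ?thesis unfolding True by simp
  next
    case False
    then obtain a b where ab: "a \<in> T'" "b \<in> T'" "\<rho> a b = 1" "line T' \<rho> a b = l" by auto
    have "l \<subseteq> {c \<in> T. \<rho> a c \<noteq> 1} \<union> {c \<in> T. \<rho> b c \<noteq> 1}"
    proof
      fix c assume c: "c \<in> l"
      then have "c \<in> T'" using ab line_subset[OF T'_space ab(1,2)] by auto
      then have cT: "c \<in> T" unfolding T'_def by simp
      show "c \<in> {c \<in> T. \<rho> a c \<noteq> 1} \<union> {c \<in> T. \<rho> b c \<noteq> 1}"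
      proof (cases "c = a \<or> c = b")
        case True
        then show ?thesis using cT dist_self[of c] TW by force
      next
        case False
        then show ?thesis
          using mem_line_1[OF T'_space ab(1,2) \<open>c \<in> T'\<close> ab(3)] c ab(4) cT by auto
      qed
    qed
    then have "card l \<le> card ({c \<in> T. \<rho> a c \<noteq> 1} \<union> {c \<in> T. \<rho> b c \<noteq> 1})"
      using finT by (intro card_mono) auto
    also have "\<dots> \<le> deg a + deg b" unfolding deg_def by (rule card_Un_le)
    finally have card_l: "real (card l) \<le> 2 * D" using ab(1,2) unfolding T'_def by simp
    have finl: "finite l" using ab(4) line_subset[OF T'_space ab(1,2)] finT' finite_subset by auto
    have "{x \<in> ?S'. (case x of (a, b) \<Rightarrow> line T' \<rho> a b) = l} \<subseteq> l \<times> l"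
      using generators_in_line[OF T'_space] by auto
    then have "card {x \<in> ?S'. (case x of (a, b) \<Rightarrow> line T' \<rho> a b) = l} \<le> card (l \<times> l)"
      using finl by (intro card_mono) auto
    then have "real (card {x \<in> ?S'. (case x of (a, b) \<Rightarrow> line T' \<rho> a b) = l}) \<le> (real (card l))\<^sup>2"
      by (simp add: card_cartesian_product power2_eq_square flip: of_nat_mult)
    also have "\<dots> \<le> (2 * D)\<^sup>2" using card_l by (intro power_mono) auto
    finally show ?thesis .
  qed
  have "real (card ?S') \<le> real (card (lines T' \<rho>)) * (2 * D)\<^sup>2"
  proof (rule card_le_fibers[OF _ _ _ fiber])
    show "finite ?S'" using finT' by (auto intro: finite_subset[of _ "T' \<times> T'"])
    show "finite (lines T' \<rho>)" by (rule finite_lines[OF T'_space])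
    show "(\<lambda>(a, b). line T' \<rho> a b) ` ?S' \<subseteq> lines T' \<rho>"
    proof safe
      fix a b assume "a \<in> T'" "b \<in> T'" "\<rho> a b = 1"
      then show "line T' \<rho> a b \<in> lines T' \<rho>"
        using dist_self[of a] T'W by (intro line_in_lines[OF T'_space]) auto
    qed
  qed
  also have "\<dots> \<le> m * (2 * D)\<^sup>2"
    using card_lines_mono[OF W T'W] unfolding m_def by (intro mult_right_mono) auto
  finally have S'_le: "real (card ?S') \<le> m * (2 * D)\<^sup>2" .
  \<comment> \<open>Each of at least \<open>3 N / 8\<close> points of \<open>T'\<close> misses at
    most \<open>N / 16\<close> others.\<close>
  have "15 / 128 * N\<^sup>2 = (3 / 8 * N) * (3 / 8 * N - N / 16)" by (simp add: power2_eq_square)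
  also have "\<dots> \<le> real (card T') * (real (card T') - N / 16)"
    using cardT' N by (intro mult_mono) auto
  also have "\<dots> \<le> real (card ?S')"
  proof (rule card_adjacent_pairs_ge[OF finT' T'W fin])
    show "real (card (nonadjacent W \<rho> a)) \<le> N / 16" if "a \<in> T'" for a
      using few[of a] that T'W unfolding N_def by auto
  qed
  also have "\<dots> \<le> m * (2 * D)\<^sup>2" by (rule S'_le)
  also have "m * (2 * D)\<^sup>2 \<le> m * (16 * m / N)\<^sup>2"
  proof -
    have "D \<le> 6 * m / (3 / 4 * N)"
      unfolding D_def using cardT N m by (intro divide_left_mono) auto
    then have "2 * D \<le> 16 * m / N" by simp
    moreover have "0 \<le> D" unfolding D_def using m by simp
    ultimately show ?thesis using m by (intro mult_left_mono power_mono) auto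
  qed
  finally have "15 / 128 * N\<^sup>2 * N\<^sup>2 \<le> m * (16 * m / N)\<^sup>2 * N\<^sup>2"
    by (rule mult_right_mono) simp
  also have "\<dots> = 256 * m ^ 3" using N by (simp add: power_divide power_mult_distrib power2_eq_square power3_eq_cube)
  finally have "15 / 128 * N ^ 4 \<le> 256 * m ^ 3"
    by (simp add: power2_eq_square power4_eq_xxxx mult.assoc)
  moreover have "0 \<le> m ^ 3" using m by simp
  \<comment> \<open>256 * 128 / 15 is far below 400000, which is dictated by the case of many
    classes.\<close>
  ultimately show ?thesis unfolding N_def m_def by linarith
qed

lemma lines_ge_diam_2:
  assumes "\<And>a. a \<in> W \<Longrightarrow> 16 * real (card (nonadjacent W \<rho> a)) \<le> real (card W)"
    and "W \<noteq> {}"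
  shows "real (card W) ^ 4 \<le> 400000 * real (card (lines W \<rho>)) ^ 3"
  using lines_ge_of_many_twin_classes[OF assms(1)] lines_ge_of_few_twin_classes[OF assms(1) _ assms(2)]
    linear by blast

end

section \<open>Reduction to distances 1 and 2\<close>

lemma lines_ge:
  assumes V: "three_metric_space V \<rho>" and n: "card V \<ge> 128"
  shows "real (card V) ^ 4 \<le> 6400000 * real (card (lines V \<rho>)) ^ 3"
proof -
  define n where "n = real (card V)"
  define m where "m = real (card (lines V \<rho>))"
  have fin: "finite V" by (rule finite_points[OF V])
  let ?P = "\<lambda>\<delta>. {(a, b) \<in> V \<times> V. \<rho> a b = \<delta>}"
  show ?thesis
  proof (cases "n\<^sup>2 / 128 \<le> real (card (?P 2)) + real (card (?P 3))")
    case True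
    then have "n\<^sup>2 / 256 \<le> real (card (?P 2)) \<or> n\<^sup>2 / 256 \<le> real (card (?P 3))" by linarith
    then have "(n\<^sup>2 / 256)\<^sup>2 \<le> 20 * m ^ 3"
    proof
      assume "n\<^sup>2 / 256 \<le> real (card (?P 2))"
      then have "(n\<^sup>2 / 256)\<^sup>2 \<le> (real (card (?P 2)))\<^sup>2" by (intro power_mono) auto
      also have "\<dots> \<le> 20 * m ^ 3" unfolding m_def by (rule card_pairs_far_le[OF V]) simp
      finally show ?thesis .
    next
      assume "n\<^sup>2 / 256 \<le> real (card (?P 3))"
      then have "(n\<^sup>2 / 256)\<^sup>2 \<le> (real (card (?P 3)))\<^sup>2" by (intro power_mono) auto
      also have "\<dots> \<le> 20 * m ^ 3" unfolding m_def by (rule card_pairs_far_le[OF V]) simp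
      finally show ?thesis .
    qed
    moreover have "(n\<^sup>2 / 256)\<^sup>2 = n ^ 4 / 65536" by (simp add: power_divide flip: power_mult)
    moreover have "0 \<le> m ^ 3" unfolding m_def by simp
    \<comment> \<open>Here 20 * 65536 = 1310720 suffices; 6400000 is needed in the other case, where
      halving the space costs a factor 16.\<close>
    ultimately show ?thesis unfolding n_def m_def by linarith
  next
    case False
    define deg where "deg = (\<lambda>a. card (nonadjacent V \<rho> a))"
    have "deg a \<le> 1 + card {b \<in> V. \<rho> a b = 2} + card {b \<in> V. \<rho> a b = 3}" if "a \<in> V" for a
    proof -
      have "nonadjacent V \<rho> a \<subseteq> {a} \<union> {b \<in> V. \<rho> a b = 2} \<union> {b \<in> V. \<rho> a b = 3}"
        using dist_cases[OF V that] unfolding nonadjacent_def by blast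
      then have "deg a \<le> card ({a} \<union> {b \<in> V. \<rho> a b = 2} \<union> {b \<in> V. \<rho> a b = 3})"
        unfolding deg_def using fin by (intro card_mono) auto
      also have "\<dots> \<le> card {a} + card {b \<in> V. \<rho> a b = 2} + card {b \<in> V. \<rho> a b = 3}"
        by (intro order_trans[OF card_Un_le] add_mono card_Un_le order_refl)
      finally show ?thesis by simp
    qed
    then have "(\<Sum>a\<in>V. deg a) \<le>
        (\<Sum>a\<in>V. 1 + card {b \<in> V. \<rho> a b = 2} + card {b \<in> V. \<rho> a b = 3})" by (rule sum_mono)
    also have "\<dots> = card V + card (?P 2) + card (?P 3)"
      unfolding card_pairs_eq_sum[OF fin] sum.distrib by simp
    finally have "real (\<Sum>a\<in>V. deg a) \<le> n + n\<^sup>2 / 128" using False unfolding n_def by linarith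
    \<comment> \<open>The assumption \<open>n >= 128\<close> absorbs the self-counts in
      \<open>deg\<close>.\<close>
    moreover have "n \<le> n\<^sup>2 / 128" using n unfolding n_def by (simp add: power2_eq_square)
    moreover have "n / 64 * real (card V) = n\<^sup>2 / 64" unfolding n_def by (simp add: power2_eq_square)
    ultimately have sum_deg: "real (\<Sum>a\<in>V. deg a) \<le> n / 64 * real (card V)" by linarith
    \<comment> \<open>Degrees are at most \<open>n / 32\<close> and \<open>W\<close> has at least
      \<open>n / 2\<close> points, which yields the ratio 16 in \<open>few\<close>.\<close>
    define W where "W = {a \<in> V. real (deg a) \<le> 2 * (n / 64)}"
    have WV: "W \<subseteq> V" and finW: "finite W" using fin unfolding W_def by auto
    have "n > 0" using n unfolding n_def by simp
    then have cardW: "n \<le> 2 * real (card W)"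
      using card_low_degree_ge[OF fin _ sum_deg] unfolding W_def n_def by simp
    have W: "three_metric_space W \<rho>" by (rule three_metric_space_subset[OF V WV])
    have few: "16 * real (card (nonadjacent W \<rho> a)) \<le> real (card W)" if "a \<in> W" for a
    proof -
      have "card (nonadjacent W \<rho> a) \<le> deg a"
        unfolding deg_def nonadjacent_def using WV fin by (intro card_mono) auto
      then show ?thesis using that cardW unfolding W_def by simp
    qed
    have ne: "W \<noteq> {}" using cardW \<open>n > 0\<close> by auto
    \<comment> \<open>The points not at distance 1 from \<open>x\<close> or from \<open>y\<close>
      make up at most an eighth of \<open>W\<close>, so \<open>x\<close> and \<open>y\<close> have a
      common neighbour.\<close>
    have diam: "\<rho> x y \<le> 2" if xy: "x \<in> W" "y \<in> W" for x y
    proof -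
      have "card (nonadjacent W \<rho> x \<union> nonadjacent W \<rho> y) < card W"
        using card_Un_le[of "nonadjacent W \<rho> x" "nonadjacent W \<rho> y"] few[OF xy(1)] few[OF xy(2)]
          cardW \<open>n > 0\<close> by linarith
      then have "\<not> W \<subseteq> nonadjacent W \<rho> x \<union> nonadjacent W \<rho> y"
        using card_mono[of "nonadjacent W \<rho> x \<union> nonadjacent W \<rho> y" W] finW
        unfolding nonadjacent_def by fastforce
      then obtain z where "z \<in> W" "\<rho> x z = 1" "\<rho> y z = 1" unfolding nonadjacent_def by blast
      then show ?thesis using dist_tri[OF W xy(1) _ xy(2), of z] dist_sym[OF W, of y z] by simp
    qed
    have "(n / 2) ^ 4 \<le> real (card W) ^ 4" using cardW \<open>n > 0\<close> by (intro power_mono) auto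
    also have "\<dots> \<le> 400000 * real (card (lines W \<rho>)) ^ 3"
      by (rule lines_ge_diam_2[OF W diam few ne])
    also have "\<dots> \<le> 400000 * m ^ 3"
      using card_lines_mono[OF V WV] unfolding m_def by (intro mult_left_mono power_mono) auto
    finally show ?thesis unfolding n_def m_def by (simp add: power_divide)
  qed
qed

section \<open>Upper bound\<close>

text \<open>Distance 1 is adjacency in the complete multipartite graph whose parts are blocks of
  \<open>s\<close> consecutive integers.\<close>

definition block_dist :: "nat \<Rightarrow> nat \<Rightarrow> nat \<Rightarrow> real" where
  "block_dist s i j = (if i = j then 0 else if i div s = j div s then 2 else 1)"

lemma block_dist_three_metric_space: "three_metric_space {..<n} (block_dist s)"
  unfolding three_metric_space_def Metric_space_def block_dist_def by auto

text \<open>A further point has distances 2 and 1 to \<open>a\<close> and \<open>b\<close> if it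
  shares a block with one of them, and 1 to both otherwise. Hence the line depends only on the two
  blocks.\<close>

lemma line_block_dist:
  assumes "a < n" "b < n" "a div s \<noteq> b div s"
  shows "line {..<n} (block_dist s) a b = {c. c < n \<and> (c div s = a div s \<or> c div s = b div s)}"
  using assms unfolding line_def collinear_triple_def between_def block_dist_def
  by (auto split: if_splits)

lemma card_lines_block_dist_le:
  assumes "s > 0"
  shows "card (lines {..<n} (block_dist s)) \<le> (n div s + 1)\<^sup>2 + n * s"
proof -
  \<comment> \<open>The extra 1 allows for an incomplete last block. \<open>?A\<close> has one line
    for each pair of blocks; \<open>?B\<close> gives the second point of a pair inside a block by
    its offset \<open>r\<close> from the start of the block.\<close>
  let ?k = "n div s + 1"
  let ?A = "(\<lambda>(i, j). {c. c < n \<and> (c div s = i \<or> c div s = j)}) ` ({..<?k} \<times> {..<?k})"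
  let ?B = "(\<lambda>(a, r). line {..<n} (block_dist s) a (a div s * s + r)) ` ({..<n} \<times> {..<s})"
  have "lines {..<n} (block_dist s) \<subseteq> ?A \<union> ?B"
  proof
    fix l assume "l \<in> lines {..<n} (block_dist s)"
    then obtain a b where ab: "a < n" "b < n" "l = line {..<n} (block_dist s) a b"
      unfolding lines_def by auto
    show "l \<in> ?A \<union> ?B"
    proof (cases "a div s = b div s")
      case True
      then have "b = a div s * s + b mod s" by simp
      then have "l = (\<lambda>(a, r). line {..<n} (block_dist s) a (a div s * s + r)) (a, b mod s)"
        using ab(3) by simp
      moreover have "(a, b mod s) \<in> {..<n} \<times> {..<s}" using ab assms by simp
      ultimately show ?thesis by blast
    next
      case False
      have "a div s < ?k" "b div s < ?k" using ab div_le_mono[of a n s] div_le_mono[of b n s] by auto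
      moreover have "l = (\<lambda>(i, j). {c. c < n \<and> (c div s = i \<or> c div s = j)}) (a div s, b div s)"
        using ab line_block_dist[OF ab(1,2) False] by simp
      ultimately show ?thesis by blast
    qed
  qed
  then have "card (lines {..<n} (block_dist s)) \<le> card (?A \<union> ?B)"
    by (intro card_mono) auto
  also have "\<dots> \<le> card ?A + card ?B" by (rule card_Un_le)
  also have "\<dots> \<le> card ({..<?k} \<times> {..<?k}) + card ({..<n} \<times> {..<s})"
    by (intro add_mono card_image_le) auto
  finally show ?thesis by (simp add: power2_eq_square)
qed

lemma min_lines_upper:
  assumes "n \<ge> 1"
  shows "real (min_lines n) \<le> 6 * real n powr (4 / 3)"
proof -
  define x where "x = real n powr (1 / 3)"
  have x: "x \<ge> 1" unfolding x_def using assms by (intro ge_one_powr_ge_zero) auto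
  have x3: "x ^ 3 = real n" and x4: "x ^ 4 = real n powr (4 / 3)"
    unfolding x_def using assms by (simp_all add: powr_power)
  \<comment> \<open>This size balances \<open>(n / s)^2\<close> against \<open>n s\<close>: both
    become of order \<open>x ^ 4\<close>. Since \<open>x >= 1\<close>, rounding up costs at most a
    factor 2.\<close>
  define s where "s = nat \<lceil>x\<rceil>"
  have s: "x \<le> real s" "real s \<le> 2 * x" "s > 0" unfolding s_def using x by linarith+
  have "real (n div s) \<le> real n / real s" by (rule of_nat_div_le_of_nat)
  also have "\<dots> \<le> x ^ 3 / x" unfolding x3[symmetric] using s(1) x by (intro divide_left_mono) auto
  also have "\<dots> = x\<^sup>2" using x by (simp add: power2_eq_square power3_eq_cube)
  finally have "real (n div s) \<le> x\<^sup>2" .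
  moreover have "1 \<le> x\<^sup>2" using x by (rule one_le_power)
  ultimately have blocks: "real (n div s + 1) \<le> 2 * x\<^sup>2" by simp
  have "min_lines n \<le> card (lines {..<n} (block_dist s))"
    using min_lines_le[OF block_dist_three_metric_space[of n s]] by simp
  also have "\<dots> \<le> (n div s + 1)\<^sup>2 + n * s" by (rule card_lines_block_dist_le[OF s(3)])
  finally have "real (min_lines n) \<le> real ((n div s + 1)\<^sup>2 + n * s)" by (rule of_nat_mono)
  also have "\<dots> = (real (n div s + 1))\<^sup>2 + real n * real s" by simp
  also have "\<dots> \<le> (2 * x\<^sup>2)\<^sup>2 + x ^ 3 * (2 * x)"
    unfolding x3[symmetric] using blocks s(2) x by (intro add_mono power_mono mult_left_mono) auto
  also have "\<dots> = 6 * x ^ 4" by (simp add: power_mult_distrib power4_eq_xxxx power3_eq_cube power2_eq_square)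
  finally show ?thesis unfolding x4 .
qed

lemma min_lines_lower:
  assumes "n \<ge> 128"
  shows "real n powr (4 / 3) \<le> 200 * real (min_lines n)"
proof -
  obtain V :: "nat set" and \<rho> where V: "three_metric_space V \<rho>" "card V = n"
    "card (lines V \<rho>) = min_lines n"
    using min_lines_attained by blast
  have "(real n powr (4 / 3)) ^ 3 = real n ^ 4"
    using assms by (simp add: powr_power powr_realpow[of "real n" 4, simplified])
  also have "\<dots> \<le> 6400000 * real (min_lines n) ^ 3"
    using lines_ge[OF V(1)] V(2,3) assms by simp
  \<comment> \<open>200 cubed is 8000000.\<close>
  also have "\<dots> \<le> (200 * real (min_lines n)) ^ 3" by (simp add: power_mult_distrib)
  finally show ?thesis by (subst (asm) power_mono_iff) auto
qed

theorem mainTheorem6: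
  "(\<lambda>n. real (min_lines n)) \<in> \<Theta>(\<lambda>n. real n powr (4 / 3))"
proof (rule bigthetaI)
  have "eventually (\<lambda>n. norm (real (min_lines n)) \<le> 6 * norm (real n powr (4 / 3))) sequentially"
    using eventually_ge_at_top[of 1] by eventually_elim (use min_lines_upper in auto)
  then show "(\<lambda>n. real (min_lines n)) \<in> O(\<lambda>n. real n powr (4 / 3))" by (rule bigoI)
  have "eventually (\<lambda>n. norm (real n powr (4 / 3)) \<le> 200 * norm (real (min_lines n))) sequentially"
    using eventually_ge_at_top[of 128] by eventually_elim (use min_lines_lower in auto)
  then have "(\<lambda>n. real n powr (4 / 3)) \<in> O(\<lambda>n. real (min_lines n))" by (rule bigoI)
  then show "(\<lambda>n. real (min_lines n)) \<in> \<Omega>(\<lambda>n. real n powr (4 / 3))"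
    by (simp only: bigomega_iff_bigo)
qed

end
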